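(* Let $f:\mathcal{M}\to\mathbb{R}$ be $\mathcal{C}^1$-smooth and let $L>0$. Suppose: (1) (descent condition) $f(\mathcal{R}_x(\eta))\le f(x)+\langle \mathrm{grad} f(x),\eta\rangle_x+\frac{L}{2}\|\eta\|^2$ for all $x\in\mathcal{M}$, $\eta\in T_x\mathcal{M}$; (2) (Lipschitz gradient, $f\in\mathcal{C}^{1,L}$) $\|\mathcal{T}_y^x\,\mathrm{grad} f(y)-\mathrm{grad} f(x)\|\le L\|\eta\|$ for all $x\in\mathcal{M}$, $\eta\in T_x\mathcal{M}$, where $y=\mathcal{R}_x(\eta)$. Let $\{t_k\}_{k\ge1}\subset(0,\infty)$ and $\{\epsilon_k\}_{k\ge1}\subset(0,\infty)$ satisfy $$\sum_{k=1}^\infty t_k=\infty,\quad t_k\downarrow 0,\quad \sum_{k=1}^\infty t_k\epsilon_k<\infty,\quad \limsup_{k\to\infty}\epsilon_k<2.$$ Let $\{x_k\}_{k\ge 1}\subset\mathcal{M}$ be a sequence generated by the inexact Riemannian gradient descent (IRGD) method $$x_{k+1}=\mathcal{R}_{x_k}(-t_kg_k),\quad g_k\in T_{x_k}\mathcal{M},\quad \|g_k-\mathrm{grad} f(x_k)\|\le\epsilon_k,\qquad k=1,2,\ldots,$$ and suppose that $\inf_{k}f(x_k)>-\infty$. Then: (i) $\mathrm{grad} f(x_k)\to 0$ (i.e. $\|\mathrm{grad} f(x_k)\|\to0$), and thus every accumulation point of $\{x_k\}$ is a stationary point of $f$. (ii) If $\bar x$ is an accumulation point of $\{x_k\}$,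 then $f(x_k)\to f(\bar x)$.
   Context: $\mathcal{M}\subset\mathbb{R}^n$ is a Riemannian submanifold embedded in $\mathbb{R}^n$, with inner product $\langle\cdot,\cdot\rangle_x$ on $T_x\mathcal{M}$ varying smoothly in $x$ and induced norm $\|\cdot\|$ on tangent vectors. The Riemannian gradient $\mathrm{grad} f(x)\in T_x\mathcal{M}$ is the unique tangent vector with $\langle\mathrm{grad} f(x),\xi\rangle_x=Df(x)[\xi]$ for all $\xi\in T_x\mathcal{M}$; $\bar x\in\mathcal{M}$ is stationary for $f$ if $\mathrm{grad} f(\bar x)=0$. $\mathcal{R}:T\mathcal{M}\to\mathcal{M}$ is a retraction: a smooth map whose restriction $\mathcal{R}_x$ to $T_x\mathcal{M}$ satisfies $\mathcal{R}_x(0_x)=x$ and $D\mathcal{R}_x(0_x)=\mathrm{id}_{T_x\mathcal{M}}$ for all $x$. $\mathcal{T}$ is a vector transport: a smooth map $(\eta_x,\xi_x)\mapsto\mathcal{T}_{\eta_x}(\xi_x)\in T_{\mathcal{R}_x(\eta_x)}\mathcal{M}$, linear in $\xi_x$, with $\mathcal{T}_{0_x}\xi_x=\xi_x$; it is isometric: $\langle\mathcal{T}_{\eta_x}\xi_x,\mathcal{T}_{\eta_x}\zeta_x\rangle_{\mathcal{R}_x(\eta_x)}=\langle\xi_x,\zeta_x\rangle_x$. For $y=\mathcal{R}_x(\eta)$, $\mathcal{T}_y^x:T_y\mathcal{M}\to T_x\mathcal{M}$ denotes the inverse $\mathcal{T}_\eta^{-1}$ of $\mathcal{T}_\eta:T_x\mathcal{M}\to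 T_y\mathcal{M}$. $t_k\downarrow0$ means that $t_k$ decreases to $0$. Accumulation points are taken in $\mathcal{M}$. *)

theory Defs
  imports "HOL-Analysis.Analysis"
begin

section \<open>Differentiability classes\<close>

text \<open>On an open subset of a finite-dimensional space, a map is of class \<open>C\<^sup>k\<^sup>+\<^sup>1\<close> iff it is
  differentiable and all its directional derivatives are of class \<open>C\<^sup>k\<close>. The predicate is meant
  for open \<open>U\<close> only.\<close>

primrec nat_Ck_on ::
    "nat \<Rightarrow> 'a::euclidean_space set \<Rightarrow> ('a \<Rightarrow> 'b::euclidean_space) \<Rightarrow> bool" where
  "nat_Ck_on 0 U F \<longleftrightarrow> continuous_on U F"
| "nat_Ck_on (Suc k) U F \<longleftrightarrow>
     (\<forall>x\<in>U. F differentiable (at x)) \<and>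
     (\<forall>v. nat_Ck_on k U (\<lambda>x. frechet_derivative F (at x) v))"

definition Ck_on ::
    "enat \<Rightarrow> 'a::euclidean_space set \<Rightarrow> ('a \<Rightarrow> 'b::euclidean_space) \<Rightarrow> bool" where
  "Ck_on k U F \<longleftrightarrow> (\<forall>j::nat. enat j \<le> k \<longrightarrow> nat_Ck_on j U F)"

text \<open>Maps on an arbitrary subset (in practice an embedded submanifold) of a Euclidean space are
  \<open>C\<^sup>k\<close> if they extend, locally around every point of the subset, to \<open>C\<^sup>k\<close> maps on open sets.
  Values outside the subset are irrelevant.\<close>

definition Ck_map_on ::
    "enat \<Rightarrow> 'a::euclidean_space set \<Rightarrow> ('a \<Rightarrow> 'b::euclidean_space) \<Rightarrow> bool" where
  "Ck_map_on k M f \<longleftrightarrow>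
     (\<forall>p\<in>M. \<exists>U F. open U \<and> p \<in> U \<and> Ck_on k U F \<and> (\<forall>x\<in>M \<inter> U. F x = f x))"

abbreviation smooth_map_on ::
    "'a::euclidean_space set \<Rightarrow> ('a \<Rightarrow> 'b::euclidean_space) \<Rightarrow> bool" where
  "smooth_map_on \<equiv> Ck_map_on \<infinity>"


section \<open>Embedded submanifolds\<close>

text \<open>The dimension is the same at all points. The model space is an arbitrary \<open>d\<close>-dimensional
  linear subspace, which amounts to \<open>\<real>\<^sup>d \<times> {0}\<close> after a linear change of coordinates.\<close>

definition embedded_submanifold :: "'a::euclidean_space set \<Rightarrow> bool" where
  "embedded_submanifold M \<longleftrightarrow>
     (\<exists>d. \<forall>p\<in>M. \<exists>U V S. \<exists>\<phi> \<psi> :: 'a \<Rightarrow> 'a.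
        open U \<and> open V \<and> p \<in> U \<and> homeomorphism U V \<phi> \<psi> \<and> Ck_on \<infinity> U \<phi> \<and> Ck_on \<infinity> V \<psi> \<and>
        subspace S \<and> dim S = d \<and> \<phi> ` (M \<inter> U) = V \<inter> S)"

definition smooth_curve_through ::
    "'a::euclidean_space set \<Rightarrow> 'a \<Rightarrow> 'a \<Rightarrow> (real \<Rightarrow> 'a) \<Rightarrow> bool" where
  "smooth_curve_through M p v c \<longleftrightarrow>
     (\<exists>e>0. Ck_on \<infinity> {-e<..<e} c \<and> c ` {-e<..<e} \<subseteq> M) \<and>
     c 0 = p \<and> (c has_vector_derivative v) (at 0)"

definition tangent_space :: "'a::euclidean_space set \<Rightarrow> 'a \<Rightarrow> 'a set" where
  "tangent_space M p = {v. \<exists>c. smooth_curve_through M p v c}"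

definition tangent_bundle :: "'a::euclidean_space set \<Rightarrow> ('a \<times> 'a) set" where
  "tangent_bundle M = {(x, v). x \<in> M \<and> v \<in> tangent_space M x}"

definition tangent_bundle2 :: "'a::euclidean_space set \<Rightarrow> ('a \<times> 'a \<times> 'a) set" where
  "tangent_bundle2 M =
     {(x, v, w). x \<in> M \<and> v \<in> tangent_space M x \<and> w \<in> tangent_space M x}"

text \<open>\<open>Df(p)[v]\<close>, i.e. the derivative at \<open>0\<close> of \<open>f \<circ> c\<close> for any curve \<open>c\<close> with \<open>c(0) = p\<close>,
  \<open>c'(0) = v\<close>.\<close>

definition differential_on ::
    "'a::euclidean_space set \<Rightarrow> ('a \<Rightarrow> real) \<Rightarrow> 'a \<Rightarrow> 'a \<Rightarrow> real" where
  "differential_on M f p v =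
     (THE d. \<forall>c. smooth_curve_through M p v c \<longrightarrow> ((f \<circ> c) has_real_derivative d) (at 0))"


section \<open>Riemannian metrics and gradients\<close>

text \<open>The metric need not be the one induced by the ambient inner product. Only the values of
  \<open>ip x\<close> on \<open>tangent_space M x\<close> for \<open>x \<in> M\<close> matter. It varies smoothly in \<open>x\<close> in the sense that
  \<open>(x, v, w) \<mapsto> \<langle>v, w\<rangle>\<^sub>x\<close> is a smooth function on the bundle of pairs of tangent vectors.\<close>

definition inner_product_on ::
    "'a::real_vector set \<Rightarrow> ('a \<Rightarrow> 'a \<Rightarrow> real) \<Rightarrow> bool" where
  "inner_product_on S b \<longleftrightarrow>
     (\<forall>u\<in>S. \<forall>v\<in>S. \<forall>w\<in>S. b (u + v) w = b u w + b v w) \<and>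
     (\<forall>r. \<forall>u\<in>S. \<forall>v\<in>S. b (r *\<^sub>R u) v = r * b u v) \<and>
     (\<forall>u\<in>S. \<forall>v\<in>S. b u v = b v u) \<and>
     (\<forall>u\<in>S. u \<noteq> 0 \<longrightarrow> b u u > 0)"

definition riemannian_submanifold ::
    "'a::euclidean_space set \<Rightarrow> ('a \<Rightarrow> 'a \<Rightarrow> 'a \<Rightarrow> real) \<Rightarrow> bool" where
  "riemannian_submanifold M ip \<longleftrightarrow>
     embedded_submanifold M \<and>
     (\<forall>x\<in>M. inner_product_on (tangent_space M x) (ip x)) \<and>
     smooth_map_on (tangent_bundle2 M) (\<lambda>(x, v, w). ip x v w)"

definition rnorm :: "('a \<Rightarrow> 'a \<Rightarrow> 'a \<Rightarrow> real) \<Rightarrow> 'a \<Rightarrow> 'a \<Rightarrow> real" where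
  "rnorm ip x v = sqrt (ip x v v)"

definition rgrad ::
    "'a::euclidean_space set \<Rightarrow> ('a \<Rightarrow> 'a \<Rightarrow> 'a \<Rightarrow> real) \<Rightarrow> ('a \<Rightarrow> real) \<Rightarrow> 'a \<Rightarrow> 'a" where
  "rgrad M ip f x =
     (THE u. u \<in> tangent_space M x \<and>
        (\<forall>\<xi>\<in>tangent_space M x. ip x u \<xi> = differential_on M f x \<xi>))"

definition stationary_point ::
    "'a::euclidean_space set \<Rightarrow> ('a \<Rightarrow> 'a \<Rightarrow> 'a \<Rightarrow> real) \<Rightarrow> ('a \<Rightarrow> real) \<Rightarrow> 'a \<Rightarrow> bool" where
  "stationary_point M ip f x \<longleftrightarrow> x \<in> M \<and> rgrad M ip f x = 0"


section \<open>Retractions and vector transports\<close>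

definition manifold_retraction ::
    "'a::euclidean_space set \<Rightarrow> ('a \<Rightarrow> 'a \<Rightarrow> 'a) \<Rightarrow> bool" where
  "manifold_retraction M R \<longleftrightarrow>
     (\<forall>x\<in>M. \<forall>\<eta>\<in>tangent_space M x. R x \<eta> \<in> M) \<and>
     smooth_map_on (tangent_bundle M) (\<lambda>(x, \<eta>). R x \<eta>) \<and>
     (\<forall>x\<in>M. R x 0 = x) \<and>
     (\<forall>x\<in>M. (R x has_derivative (\<lambda>\<xi>. \<xi>)) (at 0 within tangent_space M x))"

definition vector_transport ::
    "'a::euclidean_space set \<Rightarrow> ('a \<Rightarrow> 'a \<Rightarrow> 'a) \<Rightarrow> ('a \<Rightarrow> 'a \<Rightarrow> 'a \<Rightarrow> 'a) \<Rightarrow> bool" where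
  "vector_transport M R T \<longleftrightarrow>
     (\<forall>x\<in>M. \<forall>\<eta>\<in>tangent_space M x. \<forall>\<xi>\<in>tangent_space M x.
        T x \<eta> \<xi> \<in> tangent_space M (R x \<eta>)) \<and>
     smooth_map_on (tangent_bundle2 M) (\<lambda>(x, \<eta>, \<xi>). T x \<eta> \<xi>) \<and>
     (\<forall>x\<in>M. \<forall>\<eta>\<in>tangent_space M x. \<forall>\<xi>\<in>tangent_space M x. \<forall>\<zeta>\<in>tangent_space M x.
        T x \<eta> (\<xi> + \<zeta>) = T x \<eta> \<xi> + T x \<eta> \<zeta>) \<and>
     (\<forall>x\<in>M. \<forall>\<eta>\<in>tangent_space M x. \<forall>\<xi>\<in>tangent_space M x. \<forall>r.
        T x \<eta> (r *\<^sub>R \<xi>) = r *\<^sub>R T x \<eta> \<xi>) \<and>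
     (\<forall>x\<in>M. \<forall>\<xi>\<in>tangent_space M x. T x 0 \<xi> = \<xi>)"

definition isometric_transport ::
    "'a::euclidean_space set \<Rightarrow> ('a \<Rightarrow> 'a \<Rightarrow> 'a \<Rightarrow> real) \<Rightarrow> ('a \<Rightarrow> 'a \<Rightarrow> 'a) \<Rightarrow>
      ('a \<Rightarrow> 'a \<Rightarrow> 'a \<Rightarrow> 'a) \<Rightarrow> bool" where
  "isometric_transport M ip R T \<longleftrightarrow>
     (\<forall>x\<in>M. \<forall>\<eta>\<in>tangent_space M x. \<forall>\<xi>\<in>tangent_space M x. \<forall>\<zeta>\<in>tangent_space M x.
        ip (R x \<eta>) (T x \<eta> \<xi>) (T x \<eta> \<zeta>) = ip x \<xi> \<zeta>)"

text \<open>An isometric transport along \<open>\<eta>\<close> is injective, hence bijective between the two tangent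
  spaces since these have equal dimension; \<open>inv_into\<close> is then its inverse.\<close>

definition inverse_transport ::
    "'a::euclidean_space set \<Rightarrow> ('a \<Rightarrow> 'a \<Rightarrow> 'a \<Rightarrow> 'a) \<Rightarrow> 'a \<Rightarrow> 'a \<Rightarrow> 'a \<Rightarrow> 'a" where
  "inverse_transport M T x \<eta> = inv_into (tangent_space M x) (T x \<eta>)"


section \<open>The inexact Riemannian gradient descent method\<close>

text \<open>All sequences are indexed from \<open>1\<close>; their values at \<open>0\<close> are irrelevant.\<close>

definition IRGD_sequence ::
    "'a::euclidean_space set \<Rightarrow> ('a \<Rightarrow> 'a \<Rightarrow> 'a \<Rightarrow> real) \<Rightarrow> ('a \<Rightarrow> 'a \<Rightarrow> 'a) \<Rightarrow> ('a \<Rightarrow> real) \<Rightarrow>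
      (nat \<Rightarrow> real) \<Rightarrow> (nat \<Rightarrow> real) \<Rightarrow> (nat \<Rightarrow> 'a) \<Rightarrow> (nat \<Rightarrow> 'a) \<Rightarrow> bool" where
  "IRGD_sequence M ip R f t \<epsilon> x g \<longleftrightarrow>
     (\<forall>k\<ge>1. x k \<in> M \<and> g k \<in> tangent_space M (x k) \<and>
        rnorm ip (x k) (g k - rgrad M ip f (x k)) \<le> \<epsilon> k \<and>
        x (Suc k) = R (x k) (- t k *\<^sub>R g k))"

definition accumulation_point_in ::
    "'a::topological_space set \<Rightarrow> (nat \<Rightarrow> 'a) \<Rightarrow> 'a \<Rightarrow> bool" where
  "accumulation_point_in M x xbar \<longleftrightarrow>
     xbar \<in> M \<and> (\<exists>r::nat \<Rightarrow> nat. strict_mono r \<and> (x \<circ> r) \<longlonglongrightarrow> xbar)"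

end

theory Submission
  imports Defs
begin

text \<open>Write \<open>G\<^sub>k\<close> for the norm of the gradient at \<open>x\<^sub>k\<close>. The descent condition and
  \<open>2 \<epsilon>\<^sub>k G\<^sub>k \<le> \<epsilon>\<^sub>k (1 + G\<^sub>k\<^sup>2)\<close> give, for large \<open>k\<close>,
  \<open>f(x\<^sub>k\<^sub>+\<^sub>1) + \<delta> t\<^sub>k G\<^sub>k\<^sup>2 \<le> f(x\<^sub>k) + 3/2 t\<^sub>k \<epsilon>\<^sub>k\<close> with some \<open>\<delta> > 0\<close>, because \<open>\<epsilon>\<^sub>k\<close> stays
  below a constant less than \<open>2\<close>. Hence \<open>f(x\<^sub>k)\<close> converges and \<open>\<Sum> t\<^sub>k G\<^sub>k\<^sup>2 < \<infinity>\<close>. By the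
  Lipschitz condition and isometry of the transport, \<open>G\<^sub>k\<^sub>+\<^sub>1 \<le> G\<^sub>k + L t\<^sub>k (G\<^sub>k + \<epsilon>\<^sub>k)\<close>; after
  squaring, \<open>G\<^sub>k\<^sub>+\<^sub>1\<^sup>2 - G\<^sub>k\<^sup>2\<close> is bounded by a summable sequence, so \<open>G\<^sub>k\<^sup>2\<close> converges as
  well, and \<open>\<Sum> t\<^sub>k = \<infinity>\<close> forces its limit to be \<open>0\<close>. The passage to accumulation points is
  continuity of \<open>f\<close>, of its differential and of the metric.\<close>

section \<open>Quasi-monotone real sequences\<close>

text \<open>Subtracting the partial sums of \<open>s\<close> from \<open>a\<close> leaves a
  decreasing sequence that is bounded below; adding them back gives convergence of \<open>a\<close>.
  Summing the step inequality telescopes and bounds the partial sums of \<open>b\<close>. It serves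
  both the function values and the squared gradient norms.\<close>

lemma quasi_decreasing_convergent:
  fixes a b s :: "nat \<Rightarrow> real"
  assumes step: "\<And>n. a (Suc n) + b n \<le> a n + s n"
    and b_nonneg: "\<And>n. 0 \<le> b n" and s_nonneg: "\<And>n. 0 \<le> s n"
    and "summable s" and lower: "\<And>n. l \<le> a n"
  shows "convergent a" and "summable b"
proof -
  define p where "p n = a n - (\<Sum>i<n. s i)" for n
  have partial_le: "(\<Sum>i<n. s i) \<le> suminf s" for n
    using sum_le_suminf[OF \<open>summable s\<close>, of "{..<n}"] s_nonneg by simp
  have "p (Suc n) \<le> p n" for n
    using step[of n] b_nonneg[of n] by (simp add: p_def)
  then have "decseq p"
    by (rule decseq_SucI)
  moreover have "l - suminf s \<le> p n" for n
    using lower[of n] partial_le[of n] by (simp add: p_def)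
  ultimately have "convergent p"
    using decseq_convergent by (metis convergent_def)
  moreover have "convergent (\<lambda>n. \<Sum>i<n. s i)"
    using \<open>summable s\<close> by (simp add: summable_iff_convergent)
  ultimately have "convergent (\<lambda>n. p n + (\<Sum>i<n. s i))"
    by (rule convergent_add)
  then show "convergent a"
    by (simp add: p_def)
  have "a n + (\<Sum>i<n. b i) \<le> a 0 + (\<Sum>i<n. s i)" for n
  proof (induction n)
    case (Suc n)
    then show ?case using step[of n] by simp
  qed simp
  then have telescoped: "a n + (\<Sum>i<n. b i) \<le> a 0 + (\<Sum>i<n. s i)" for n .
  have bound: "(\<Sum>i<n. b i) \<le> a 0 + suminf s - l" for n
    using telescoped[of n] lower[of n] partial_le[of n] by linarith
  show "summable b"
    by (rule summableI_nonneg_bounded[of b "a 0 + suminf s - l"]) (use b_nonneg bound in auto)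
qed

text \<open>The analytic core, free of geometry: \<open>a\<close> stands for the function values and
  \<open>G\<close> for the gradient norms, shifted so far that the bounds on
  \<open>\<epsilon>\<close> and \<open>t\<close> hold from index 0 on.\<close>

lemma inexact_descent_convergent:
  fixes a G t \<epsilon> :: "nat \<Rightarrow> real"
  assumes "L > 0" "c < 2"
    and t_pos: "\<And>n. 0 < t n" and t_le: "\<And>n. L * t n \<le> (1 - c / 2) / 2"
    and eps: "\<And>n. 0 < \<epsilon> n" "\<And>n. \<epsilon> n \<le> c"
    and te: "summable (\<lambda>n. t n * \<epsilon> n)"
    and t_sum: "\<not> summable t"
    and lower: "\<And>n. l \<le> a n"
    and G_nonneg: "\<And>n. 0 \<le> G n"
    and descent: "\<And>n. a (Suc n) \<le> a n - t n * (G n ^ 2 - \<epsilon> n * G n) + L / 2 * t n ^ 2 * (G n + \<epsilon> n) ^ 2"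
    and lipschitz: "\<And>n. G (Suc n) \<le> G n + L * t n * (G n + \<epsilon> n)"
  shows "convergent a" and "G \<longlonglongrightarrow> 0"
proof -
  \<comment> \<open>\<open>d\<close> is what remains of the coefficient 1 of \<open>G n ^ 2\<close>
    once the gradient error has taken \<open>c / 2\<close>; it is positive because
    \<open>c < 2\<close>.\<close>
  define d where "d = 1 - c / 2"
  have "0 < c" using eps[of 0] by linarith
  have d: "0 < d" "d < 1" using \<open>c < 2\<close> \<open>0 < c\<close> by (auto simp: d_def)
  have square: "(G n + \<epsilon> n) ^ 2 \<le> 2 * G n ^ 2 + 2 * \<epsilon> n ^ 2" for n
    using zero_le_power2[of "G n - \<epsilon> n"] by (simp add: power2_eq_square algebra_simps)
  \<comment> \<open>Splitting the product this way keeps the remainder linear in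
    \<open>\<epsilon> n\<close>, so that summability of \<open>t n * \<epsilon> n\<close> suffices;
    \<open>eps_square\<close> does the same for the quadratic error.\<close>
  have cross: "2 * (\<epsilon> n * G n) \<le> \<epsilon> n * G n ^ 2 + \<epsilon> n" for n
  proof -
    have "0 \<le> \<epsilon> n * (G n - 1)\<^sup>2" using eps(1)[of n] by simp
    then show ?thesis by (simp add: power2_eq_square algebra_simps)
  qed
  have eps_square: "\<epsilon> n ^ 2 \<le> 2 * \<epsilon> n" for n
    using mult_right_mono[of "\<epsilon> n" 2 "\<epsilon> n"] eps[of n] \<open>c < 2\<close> by (simp add: power2_eq_square)
  have eps_G: "\<epsilon> n * G n ^ 2 \<le> c * G n ^ 2" for n
    by (rule mult_right_mono) (use eps in auto)
  \<comment> \<open>By \<open>t_le\<close>, \<open>L * t n\<close> is at most \<open>d / 2\<close>.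
    With the factor 1/2 from \<open>descent\<close>, the second-order term then consumes only half
    of the available decrease \<open>d * G n ^ 2\<close>.\<close>
  have second_order: "L * t n * (G n + \<epsilon> n) ^ 2 \<le> d * G n ^ 2 + 2 * \<epsilon> n" for n
  proof -
    have "L * t n * (G n + \<epsilon> n) ^ 2 \<le> (d / 2) * (2 * G n ^ 2 + 2 * \<epsilon> n ^ 2)"
      by (rule mult_mono) (use t_le d square in \<open>auto simp: d_def\<close>)
    also have "\<dots> \<le> d * G n ^ 2 + 2 * \<epsilon> n"
      using eps_square[of n] mult_right_mono[of d 1 "\<epsilon> n ^ 2"] d by (simp add: algebra_simps)
    finally show ?thesis .
  qed
  have "a (Suc n) + d / 2 * (t n * G n ^ 2) \<le> a n + 3 / 2 * (t n * \<epsilon> n)" for n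
  proof -
    \<comment> \<open>The 3/2 collects 1/2 from \<open>cross\<close> and 1 from half of
      \<open>second_order\<close>.\<close>
    have "- (G n ^ 2 - \<epsilon> n * G n) + L / 2 * t n * (G n + \<epsilon> n) ^ 2
        \<le> - d / 2 * G n ^ 2 + 3 / 2 * \<epsilon> n"
    proof -
      have "d * G n ^ 2 = G n ^ 2 - c * G n ^ 2 / 2"
        by (simp add: d_def left_diff_distrib)
      moreover have "- d / 2 * G n ^ 2 = - (d * G n ^ 2) / 2"
        "L / 2 * t n * (G n + \<epsilon> n) ^ 2 = L * t n * (G n + \<epsilon> n) ^ 2 / 2"
        by simp_all
      ultimately show ?thesis
        using second_order[of n] cross[of n] eps_G[of n] by linarith
    qed
    from mult_left_mono[OF this less_imp_le[OF t_pos[of n]]] show ?thesis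
      using descent[of n] by (simp add: power2_eq_square algebra_simps)
  qed
  moreover have "summable (\<lambda>n. 3 / 2 * (t n * \<epsilon> n))"
    by (rule summable_mult[OF te])
  moreover have "0 \<le> d / 2 * (t n * G n ^ 2)" "0 \<le> 3 / 2 * (t n * \<epsilon> n)" for n
    using d t_pos[of n] eps(1)[of n] by auto
  ultimately have "convergent a" "summable (\<lambda>n. d / 2 * (t n * G n ^ 2))"
    using lower quasi_decreasing_convergent[of a "\<lambda>n. d / 2 * (t n * G n ^ 2)"
        "\<lambda>n. 3 / 2 * (t n * \<epsilon> n)" l] by blast+
  then show "convergent a" by simp
  from \<open>summable (\<lambda>n. d / 2 * (t n * G n ^ 2))\<close> d(1) have tG: "summable (\<lambda>n. t n * G n ^ 2)"
    by (simp add: summable_cmult_iff)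
  \<comment> \<open>The constants arise as 5 = 2 + 2 + 1 and 3 = 1 + 2 from the three terms of the
    expanded square. The subtracted sequence is 0 here, since only convergence of
    \<open>G n ^ 2\<close> is wanted.\<close>
  have "G (Suc n) ^ 2 + 0 \<le> G n ^ 2 + (5 * L * (t n * G n ^ 2) + 3 * L * (t n * \<epsilon> n))" for n
  proof -
    have Lt: "0 < L * t n" using \<open>L > 0\<close> t_pos[of n] by simp
    have "G (Suc n) ^ 2 \<le> (G n + L * t n * (G n + \<epsilon> n)) ^ 2"
      using lipschitz[of n] G_nonneg by (rule power_mono)
    also have "\<dots> = G n ^ 2 + L * t n * (2 * G n ^ 2 + 2 * (\<epsilon> n * G n) + L * t n * (G n + \<epsilon> n) ^ 2)"
      by (simp add: power2_eq_square algebra_simps)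
    also have "\<dots> \<le> G n ^ 2 + L * t n * (5 * G n ^ 2 + 3 * \<epsilon> n)"
    proof -
      have "2 * (\<epsilon> n * G n) \<le> 2 * G n ^ 2 + \<epsilon> n"
        using cross[of n] eps_G[of n] mult_right_mono[of c 2 "G n ^ 2"] \<open>c < 2\<close> by simp
      moreover have "L * t n * (G n + \<epsilon> n) ^ 2 \<le> G n ^ 2 + 2 * \<epsilon> n"
        using second_order[of n] mult_right_mono[of d 1 "G n ^ 2"] d by simp
      ultimately show ?thesis
        using Lt by (intro add_left_mono mult_left_mono) auto
    qed
    finally show ?thesis by (simp add: algebra_simps)
  qed
  moreover have "summable (\<lambda>n. 5 * L * (t n * G n ^ 2) + 3 * L * (t n * \<epsilon> n))"
    by (intro summable_add summable_mult tG te)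
  moreover have "0 \<le> 5 * L * (t n * G n ^ 2) + 3 * L * (t n * \<epsilon> n)" for n
    using \<open>L > 0\<close> t_pos[of n] eps(1)[of n] by auto
  ultimately have "convergent (\<lambda>n. G n ^ 2)"
    using quasi_decreasing_convergent(1)[of "\<lambda>n. G n ^ 2" "\<lambda>_. 0"
        "\<lambda>n. 5 * L * (t n * G n ^ 2) + 3 * L * (t n * \<epsilon> n)" 0] by simp
  then obtain m where m: "(\<lambda>n. G n ^ 2) \<longlonglongrightarrow> m" by (auto simp: convergent_def)
  have "m = 0"
  proof (rule ccontr)
    assume "m \<noteq> 0"
    moreover have "0 \<le> m"
      by (rule LIMSEQ_le_const[OF m]) auto
    ultimately have "0 < m" by simp
    then have "\<forall>\<^sub>F n in sequentially. m / 2 < G n ^ 2"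
      by (intro order_tendstoD(1)[OF m]) simp
    \<comment> \<open>A positive limit \<open>m\<close> would dominate \<open>t\<close> by a
      multiple of the summable sequence \<open>t n * G n ^ 2\<close>.\<close>
    then have "\<forall>\<^sub>F n in sequentially. norm (t n) \<le> 2 / m * (t n * G n ^ 2)"
    proof eventually_elim
      case (elim n)
      then show ?case
        using mult_left_mono[of "m / 2" "G n ^ 2" "t n"] t_pos[of n] \<open>0 < m\<close>
        by (simp add: field_simps)
    qed
    then have "summable t"
      by (rule summable_comparison_test_ev) (rule summable_mult[OF tG])
    with t_sum show False by simp
  qed
  with m have "(\<lambda>n. sqrt (G n ^ 2)) \<longlonglongrightarrow> 0"
    using tendsto_real_sqrt by fastforce
  then show "G \<longlonglongrightarrow> 0" using G_nonneg by simp
qed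

section \<open>Linear algebra on subspaces\<close>

text \<open>Metric, differential and transport are controlled only on tangent spaces. Prescribing
  the values of \<open>h\<close> on a basis of \<open>S\<close> yields a globally linear map, to
  which dimension arguments apply.\<close>

lemma linear_on_subspace_extend:
  fixes h :: "'a::euclidean_space \<Rightarrow> 'b::euclidean_space"
  assumes S: "subspace S"
    and add: "\<And>u v. u \<in> S \<Longrightarrow> v \<in> S \<Longrightarrow> h (u + v) = h u + h v"
    and scale: "\<And>r u. u \<in> S \<Longrightarrow> h (r *\<^sub>R u) = r *\<^sub>R h u"
  obtains k where "linear k" "\<And>u. u \<in> S \<Longrightarrow> k u = h u"
proof -
  obtain B where B: "B \<subseteq> S" "independent B" "S \<subseteq> span B"
    by (rule basis_exists[of S])
  obtain k where k: "linear k" "\<And>b. b \<in> B \<Longrightarrow> k b = h b"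
    using linear_independent_extend[OF B(2)] by blast
  interpret k: linear k by fact
  \<comment> \<open>Membership in \<open>S\<close> travels with the equality through the induction,
    because \<open>h\<close> may be split only on arguments from \<open>S\<close>.\<close>
  have "u \<in> S \<and> k u = h u" if "u \<in> span B" for u
    using that
  proof (induction rule: span_induct_alt)
    case base
    show ?case using scale[of 0 0] subspace_0[OF S] by (simp add: k.zero)
  next
    case (step r b v)
    then have "b \<in> S" "r *\<^sub>R b \<in> S" "v \<in> S" using B(1) S by (auto simp: subspace_scale)
    then show ?case
      using step k(2) S by (simp add: add scale k.add k.scale subspace_add)
  qed
  with k(1) B(3) show thesis using that by blast
qed

text \<open>A trivial kernel preserves the dimension, and a subspace of \<open>W\<close> of the same
  dimension is all of \<open>W\<close>. This gives both the Riesz representation and the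
  invertibility of the transport.\<close>

lemma linear_on_subspace_surj:
  fixes h :: "'a::euclidean_space \<Rightarrow> 'b::euclidean_space"
  assumes S: "subspace S" and W: "subspace W" and dim: "dim S = dim W"
    and add: "\<And>u v. u \<in> S \<Longrightarrow> v \<in> S \<Longrightarrow> h (u + v) = h u + h v"
    and scale: "\<And>r u. u \<in> S \<Longrightarrow> h (r *\<^sub>R u) = r *\<^sub>R h u"
    and "h ` S \<subseteq> W"
    and ker: "\<And>u. u \<in> S \<Longrightarrow> h u = 0 \<Longrightarrow> u = 0"
  shows "h ` S = W"
proof -
  obtain k where k: "linear k" "\<And>u. u \<in> S \<Longrightarrow> k u = h u"
    using linear_on_subspace_extend[of S h] S add scale by metis
  have "inj_on k S"
    using linear_inj_on_iff_eq_0[OF k(1) S] ker k(2) by auto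
  then have "dim (k ` S) = dim S"
    using dim_image_eq[OF k(1), of S] S by (metis span_eq_iff)
  moreover have image: "k ` S = h ` S" using k(2) by simp
  ultimately have "dim (h ` S) = dim W" "subspace (h ` S)"
    using dim linear_subspace_image[OF k(1) S] by auto
  with W \<open>h ` S \<subseteq> W\<close> show ?thesis
    using subspace_dim_equal[of "h ` S" W] by simp
qed

section \<open>Inner products given on a linear subspace only\<close>

locale subspace_inner =
  fixes S :: "'a::euclidean_space set" and b :: "'a \<Rightarrow> 'a \<Rightarrow> real"
  assumes S: "subspace S" and inner: "inner_product_on S b"
begin

lemma b_add: "u \<in> S \<Longrightarrow> v \<in> S \<Longrightarrow> w \<in> S \<Longrightarrow> b (u + v) w = b u w + b v w"
  and b_scale: "u \<in> S \<Longrightarrow> v \<in> S \<Longrightarrow> b (r *\<^sub>R u) v = r * b u v"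
  and b_commute: "u \<in> S \<Longrightarrow> v \<in> S \<Longrightarrow> b u v = b v u"
  and b_pos: "u \<in> S \<Longrightarrow> u \<noteq> 0 \<Longrightarrow> 0 < b u u"
  using inner by (auto simp: inner_product_on_def)

lemma b_scale_right: "u \<in> S \<Longrightarrow> v \<in> S \<Longrightarrow> b u (r *\<^sub>R v) = r * b u v"
  by (metis S b_commute b_scale subspace_scale)

lemma b_add_right: "u \<in> S \<Longrightarrow> v \<in> S \<Longrightarrow> w \<in> S \<Longrightarrow> b w (u + v) = b w u + b w v"
  by (metis S b_commute b_add subspace_add)

lemma b_diff: "u \<in> S \<Longrightarrow> v \<in> S \<Longrightarrow> w \<in> S \<Longrightarrow> b (u - v) w = b u w - b v w"
  using b_add[of u "- 1 *\<^sub>R v" w] b_scale[of v w "- 1"] subspace_scale[OF S, of v "- 1"] by simp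

lemma b_diff_right: "u \<in> S \<Longrightarrow> v \<in> S \<Longrightarrow> w \<in> S \<Longrightarrow> b w (u - v) = b w u - b w v"
  by (metis S b_commute b_diff subspace_diff)

lemma b_zero: "u \<in> S \<Longrightarrow> b 0 u = 0"
  using b_scale[of u u 0] by simp

lemma b_nonneg: "u \<in> S \<Longrightarrow> 0 \<le> b u u"
  using b_pos[of u] b_zero[of u] by (cases "u = 0") auto

lemma Cauchy_Schwarz:
  assumes "u \<in> S" "v \<in> S"
  shows "\<bar>b u v\<bar> \<le> sqrt (b u u) * sqrt (b v v)"
proof (cases "v = 0")
  case True
  then have "b u v = 0" using b_scale_right[of u v 0] assms by simp
  then show ?thesis using True b_zero[OF assms(2)] by simp
next
  case False
  have v: "0 < b v v" using b_pos assms False by simp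
  \<comment> \<open>\<open>r *\<^sub>R v\<close> is the \<open>b\<close>-orthogonal projection of
    \<open>u\<close> onto the line of \<open>v\<close>; nonnegativity of \<open>b\<close> on the
    remainder is the squared inequality.\<close>
  define r where "r = b u v / b v v"
  have "r *\<^sub>R v \<in> S" using assms S by (simp add: subspace_scale)
  then have "b (u - r *\<^sub>R v) (u - r *\<^sub>R v) = b u u - 2 * r * b u v + r * (r * b v v)"
    using assms S by (simp add: b_diff b_diff_right b_scale b_scale_right subspace_diff
        b_commute[of v u] algebra_simps)
  also have "\<dots> = b u u - (b u v)\<^sup>2 / b v v"
    using v by (simp add: r_def power2_eq_square field_simps)
  finally have "0 \<le> b u u - (b u v)\<^sup>2 / b v v"
    using b_nonneg[of "u - r *\<^sub>R v"] assms \<open>r *\<^sub>R v \<in> S\<close> S by (simp add: subspace_diff)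
  then have "(b u v)\<^sup>2 \<le> b u u * b v v"
    using v by (simp add: field_simps)
  then have "sqrt ((b u v)\<^sup>2) \<le> sqrt (b u u * b v v)" by (rule real_sqrt_le_mono)
  then show ?thesis by (simp add: real_sqrt_mult)
qed

lemma triangle:
  assumes "u \<in> S" "v \<in> S"
  shows "sqrt (b (u + v) (u + v)) \<le> sqrt (b u u) + sqrt (b v v)"
proof (rule real_le_lsqrt)
  show "0 \<le> sqrt (b u u) + sqrt (b v v)" using assms b_nonneg by simp
  have "b (u + v) (u + v) = b u u + 2 * b u v + b v v"
    using assms S by (simp add: b_add b_add_right subspace_add b_commute[of v u])
  also have "\<dots> \<le> b u u + 2 * (sqrt (b u u) * sqrt (b v v)) + b v v"
    using Cauchy_Schwarz[OF assms] by simp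
  also have "\<dots> = (sqrt (b u u) + sqrt (b v v))\<^sup>2"
    using assms b_nonneg by (simp add: power2_sum)
  finally show "b (u + v) (u + v) \<le> (sqrt (b u u) + sqrt (b v v))\<^sup>2" .
qed

lemma sqrt_scale:
  assumes "u \<in> S"
  shows "sqrt (b (r *\<^sub>R u) (r *\<^sub>R u)) = \<bar>r\<bar> * sqrt (b u u)"
  using assms S by (simp add: b_scale b_scale_right subspace_scale real_sqrt_mult flip: mult.assoc)

text \<open>An orthonormal basis of \<open>S\<close> with respect to the ambient inner product turns both the
  functional and \<open>b\<close> into maps \<open>S \<rightarrow> S\<close>, and the second of these is bijective.\<close>

lemma Riesz:
  assumes l_add: "\<And>u v. u \<in> S \<Longrightarrow> v \<in> S \<Longrightarrow> l (u + v) = l u + l v"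
    and l_scale: "\<And>r u. u \<in> S \<Longrightarrow> l (r *\<^sub>R u) = r * l u"
  shows "\<exists>!u. u \<in> S \<and> (\<forall>v\<in>S. b u v = l v)"
proof -
  obtain B where B: "B \<subseteq> S" "pairwise orthogonal B" "\<And>x. x \<in> B \<Longrightarrow> norm x = 1"
      "independent B" "card B = dim S" "span B = S"
    using orthonormal_basis_subspace[OF S] by metis
  have "finite B" using B(4) independent_imp_finite by blast
  have coeff: "(\<Sum>e\<in>B. h e *\<^sub>R e) \<bullet> e' = h e'" if "e' \<in> B" for h :: "'a \<Rightarrow> real" and e'
  proof -
    have "(\<Sum>e\<in>B. h e *\<^sub>R e) \<bullet> e' = (\<Sum>e\<in>B. if e = e' then h e' else 0)"
      unfolding inner_sum_left
      using B(2) that B(3)[OF that]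
      by (intro sum.cong) (auto simp: pairwise_def orthogonal_def norm_eq_1)
    then show ?thesis using that \<open>finite B\<close> by simp
  qed
  \<comment> \<open>Functionals that are linear on \<open>S\<close> are determined by their values
    on the basis \<open>B\<close>.\<close>
  have agree: "h v = h' v"
    if "\<And>e. e \<in> B \<Longrightarrow> h e = h' e" and "v \<in> S"
      and h: "\<And>u v. u \<in> S \<Longrightarrow> v \<in> S \<Longrightarrow> h (u + v) = h u + h v"
        "\<And>r u. u \<in> S \<Longrightarrow> h (r *\<^sub>R u) = r *\<^sub>R h u"
      and h': "\<And>u v. u \<in> S \<Longrightarrow> v \<in> S \<Longrightarrow> h' (u + v) = h' u + h' v"
        "\<And>r u. u \<in> S \<Longrightarrow> h' (r *\<^sub>R u) = r *\<^sub>R h' u"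
    for h h' :: "'a \<Rightarrow> real" and v
  proof -
    obtain k where k: "linear k" "\<And>u. u \<in> S \<Longrightarrow> k u = h u"
      using linear_on_subspace_extend[of S h, OF S h] by blast
    obtain k' where k': "linear k'" "\<And>u. u \<in> S \<Longrightarrow> k' u = h' u"
      using linear_on_subspace_extend[of S h', OF S h'] by blast
    have "k e = k' e" if "e \<in> B" for e
      using that \<open>\<And>e. e \<in> B \<Longrightarrow> h e = h' e\<close> B(1) k(2) k'(2) by (metis subsetD)
    then have "k v = k' v"
      using linear_eq_on_span[OF k(1) k'(1), of B v] \<open>v \<in> S\<close> B(6) by simp
    then show ?thesis using k(2) k'(2) \<open>v \<in> S\<close> by simp
  qed
  \<comment> \<open>\<open>A u\<close> represents the functional \<open>b u\<close> in the ambient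
    inner product. If it vanishes, then \<open>b u\<close> vanishes on \<open>B\<close>, hence at
    \<open>u\<close> itself, and \<open>u\<close> is 0.\<close>
  define A where "A u = (\<Sum>e\<in>B. b u e *\<^sub>R e)" for u
  have "A ` S = S"
  proof (rule linear_on_subspace_surj[OF S S refl])
    fix u v assume "u \<in> S" "v \<in> S"
    then show "A (u + v) = A u + A v"
      unfolding A_def sum.distrib[symmetric] using B(1)
      by (intro sum.cong) (auto simp: b_add scaleR_left_distrib)
  next
    fix r u assume "u \<in> S"
    then show "A (r *\<^sub>R u) = r *\<^sub>R A u"
      unfolding A_def scaleR_sum_right using B(1) by (intro sum.cong) (auto simp: b_scale)
  next
    show "A ` S \<subseteq> S"
      using B(1) S by (auto simp: A_def intro!: subspace_sum subspace_scale)
  next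
    fix u assume u: "u \<in> S" "A u = 0"
    then have "b u e = 0" if "e \<in> B" for e using coeff[OF that, of "b u"] by (simp add: A_def)
    then have "b u u = 0"
      using agree[of "b u" "\<lambda>_. 0" u] u S by (simp add: b_add_right b_scale_right)
    then show "u = 0" using b_pos[OF u(1)] by force
  qed
  moreover have "(\<Sum>e\<in>B. l e *\<^sub>R e) \<in> S"
    using B(1) S by (auto intro!: subspace_sum subspace_scale)
  ultimately obtain u where u: "u \<in> S" "A u = (\<Sum>e\<in>B. l e *\<^sub>R e)" by (metis imageE)
  have "b u e = l e" if "e \<in> B" for e
    using coeff[OF that, of "b u"] coeff[OF that, of l] u(2) by (simp add: A_def)
  then have "\<forall>v\<in>S. b u v = l v"
    using agree[of "b u" l] u(1) l_add l_scale by (simp add: b_add_right b_scale_right)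
  moreover have "u' = u" if "u' \<in> S" "\<forall>v\<in>S. b u' v = l v" for u'
  proof -
    have "u' - u \<in> S" using that u S by (simp add: subspace_diff)
    then have "b (u' - u) (u' - u) = 0"
      using that u(1) \<open>\<forall>v\<in>S. b u v = l v\<close> by (simp add: b_diff)
    then show ?thesis using b_pos[OF \<open>u' - u \<in> S\<close>] by force
  qed
  ultimately show ?thesis using u(1) by blast
qed

end

section \<open>Differentiability classes and charts\<close>

text \<open>The recursion passes through \<open>frechet_derivative\<close>, which sees a whole
  neighbourhood of the point. Openness of \<open>U\<close> makes agreement on \<open>U\<close> pass
  to the derivatives, so the induction can go on.\<close>

lemma nat_Ck_on_cong:
  assumes "open U" "\<And>x. x \<in> U \<Longrightarrow> F x = G x" "nat_Ck_on k U F"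
  shows "nat_Ck_on k U G"
  using assms(2,3)
proof (induction k arbitrary: F G)
  case 0
  then show ?case by (simp cong: continuous_on_cong)
next
  case (Suc k)
  have deriv: "(G has_derivative frechet_derivative F (at x)) (at x)" if "x \<in> U" for x
  proof -
    have "(F has_derivative frechet_derivative F (at x)) (at x)"
      using Suc.prems(2) that by (simp add: frechet_derivative_works)
    then show ?thesis
      by (rule has_derivative_transform_within_open[OF _ \<open>open U\<close> that Suc.prems(1)])
  qed
  then have "frechet_derivative F (at x) v = frechet_derivative G (at x) v" if "x \<in> U" for x v
    using that frechet_derivative_at by metis
  moreover have "nat_Ck_on k U (\<lambda>x. frechet_derivative F (at x) v)" for v
    using Suc.prems(2) by simp
  ultimately have "nat_Ck_on k U (\<lambda>x. frechet_derivative G (at x) v)" for v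
    using Suc.IH[of "\<lambda>x. frechet_derivative F (at x) v" "\<lambda>x. frechet_derivative G (at x) v"]
    by simp
  with deriv show ?case by (auto simp: differentiable_def)
qed

text \<open>Along a line, the derivative in direction \<open>r\<close> is the derivative of
  \<open>F\<close> in the fixed direction \<open>r *\<^sub>R w\<close>, again evaluated along the
  line, so the induction closes. It makes lines in a chart into smooth curves on the
  manifold.\<close>

lemma nat_Ck_on_line:
  fixes F :: "'a::euclidean_space \<Rightarrow> 'b::euclidean_space"
  assumes "open I" "\<And>s. s \<in> I \<Longrightarrow> q + s *\<^sub>R w \<in> V" "nat_Ck_on k V F"
  shows "nat_Ck_on k I (\<lambda>s::real. F (q + s *\<^sub>R w))"
  using assms(3)
proof (induction k arbitrary: F)
  case 0
  then have "continuous_on V F" by simp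
  then show ?case
    using assms(2) by (auto intro!: continuous_on_compose2[of V F] continuous_intros)
next
  case (Suc k)
  let ?D = "\<lambda>s. frechet_derivative F (at (q + s *\<^sub>R w))"
  have deriv: "((\<lambda>s. F (q + s *\<^sub>R w)) has_derivative (\<lambda>r. ?D s (r *\<^sub>R w))) (at s)" if "s \<in> I" for s
  proof -
    have "(F has_derivative ?D s) (at (q + s *\<^sub>R w))"
      using Suc.prems assms(2)[OF that] by (simp add: frechet_derivative_works)
    moreover have "((\<lambda>s. q + s *\<^sub>R w) has_derivative (\<lambda>r. r *\<^sub>R w)) (at s)"
      by (auto intro!: derivative_eq_intros)
    ultimately show ?thesis
      using has_derivative_compose by blast
  qed
  have "nat_Ck_on k I (\<lambda>s. frechet_derivative (\<lambda>s. F (q + s *\<^sub>R w)) (at s) r)" for r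
  proof (rule nat_Ck_on_cong[OF \<open>open I\<close>])
    show "nat_Ck_on k I (\<lambda>s. ?D s (r *\<^sub>R w))"
      using Suc.IH[of "\<lambda>x. frechet_derivative F (at x) (r *\<^sub>R w)"] Suc.prems by simp
    show "?D s (r *\<^sub>R w) = frechet_derivative (\<lambda>s. F (q + s *\<^sub>R w)) (at s) r" if "s \<in> I" for s
      using frechet_derivative_at[OF deriv[OF that]] by metis
  qed
  with deriv show ?case by (auto simp: differentiable_def)
qed

lemma Ck_on_imp_continuous_on: "Ck_on k U F \<Longrightarrow> continuous_on U F"
  unfolding Ck_on_def by (metis enat_0 nat_Ck_on.simps(1) zero_le)

lemma Ck_on_imp_C1:
  assumes "Ck_on k U F" "1 \<le> k"
  shows "x \<in> U \<Longrightarrow> (F has_derivative frechet_derivative F (at x)) (at x)"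
    and "continuous_on U (\<lambda>x. frechet_derivative F (at x) v)"
proof -
  have "nat_Ck_on (Suc 0) U F"
    using assms unfolding Ck_on_def by (metis One_nat_def one_enat_def)
  then show "x \<in> U \<Longrightarrow> (F has_derivative frechet_derivative F (at x)) (at x)"
    and "continuous_on U (\<lambda>x. frechet_derivative F (at x) v)"
    by (auto simp: frechet_derivative_works)
qed

lemma Ck_map_on_imp_continuous_on:
  assumes "Ck_map_on k M f"
  shows "continuous_on M f"
  unfolding continuous_on_def
proof
  fix p assume "p \<in> M"
  then obtain U F where U: "open U" "p \<in> U" "Ck_on k U F" "\<And>x. x \<in> M \<inter> U \<Longrightarrow> F x = f x"
    using assms unfolding Ck_map_on_def by metis
  have "(F \<longlongrightarrow> F p) (at p within M)"
    using Ck_on_imp_continuous_on[OF U(3)] U(1,2)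
    by (metis at_le continuous_on_def subset_UNIV tendsto_mono at_within_open)
  moreover have "\<forall>\<^sub>F x in at p within M. F x = f x"
    using U unfolding eventually_at_topological by blast
  ultimately show "(f \<longlongrightarrow> f p) (at p within M)"
    using U(4)[of p] U(2) \<open>p \<in> M\<close> by (simp add: tendsto_cong)
qed

lemma smooth_curve_through_eventually:
  assumes "smooth_curve_through M p v c" "open U" "p \<in> U"
  shows "\<forall>\<^sub>F s in nhds 0. c s \<in> M \<inter> U"
proof -
  obtain e where e: "e > 0" "c ` {-e<..<e} \<subseteq> M" "c 0 = p" "(c has_vector_derivative v) (at 0)"
    using assms(1) unfolding smooth_curve_through_def by blast
  have "isCont c 0"
    using e(4) by (rule has_vector_derivative_continuous)
  then have "(c \<longlongrightarrow> p) (nhds 0)"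
    using e(3) tendsto_at_iff_tendsto_nhds[of c 0] by (simp add: isCont_def)
  then have "\<forall>\<^sub>F s in nhds 0. c s \<in> U"
    by (rule topological_tendstoD) (use assms in auto)
  moreover have "\<forall>\<^sub>F s in nhds 0. s \<in> {-e<..<e}"
    by (rule eventually_nhds_in_open) (use e in auto)
  ultimately show ?thesis
    by eventually_elim (use e(2) in blast)
qed

text \<open>The component \<open>z\<close> of \<open>v\<close> orthogonal to \<open>S\<close>
  satisfies \<open>v \<bullet> z = 0\<close>, since \<open>c s \<bullet> z\<close> vanishes near 0;
  hence \<open>z\<close> is 0.\<close>

lemma has_vector_derivative_in_subspace:
  fixes c :: "real \<Rightarrow> 'a::euclidean_space"
  assumes "(c has_vector_derivative v) (at 0)" "subspace S" "\<forall>\<^sub>F s in nhds 0. c s \<in> S"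
  shows "v \<in> S"
proof -
  obtain y z where yz: "y \<in> span S" "\<And>w. w \<in> span S \<Longrightarrow> orthogonal z w" "v = y + z"
    using orthogonal_subspace_decomp_exists[of S v] by metis
  have "((\<lambda>s. c s \<bullet> z) has_real_derivative v \<bullet> z) (at 0)"
    using assms(1) unfolding has_vector_derivative_def has_field_derivative_def
    by (auto intro!: derivative_eq_intros simp: fun_eq_iff)
  moreover have "\<forall>\<^sub>F s in nhds 0. c s \<bullet> z = 0"
    using assms(3) by eventually_elim (metis inner_commute orthogonal_def span_base yz(2))
  ultimately have "((\<lambda>_. 0) has_real_derivative v \<bullet> z) (at 0)"
    using DERIV_cong_ev[OF refl _ refl, of "\<lambda>s. c s \<bullet> z" "\<lambda>_. 0" 0 "v \<bullet> z"] by blast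
  then have "v \<bullet> z = 0"
    using DERIV_unique DERIV_const by blast
  moreover have "y \<bullet> z = 0"
    using yz(1,2) by (simp add: orthogonal_def inner_commute)
  ultimately have "z = 0"
    using yz(3) by (simp add: inner_add_left)
  then show ?thesis
    using yz(1,3) assms(2) by (metis add.right_neutral span_eq_iff)
qed

section \<open>Tangent spaces in a single slice chart\<close>

locale submanifold_chart =
  fixes M U V S :: "'a::euclidean_space set" and \<phi> \<psi> :: "'a \<Rightarrow> 'a"
  assumes open_U: "open U" and open_V: "open V" and homeo: "homeomorphism U V \<phi> \<psi>"
    and smooth_\<phi>: "Ck_on \<infinity> U \<phi>" and smooth_\<psi>: "Ck_on \<infinity> V \<psi>"
    and S: "subspace S" and image: "\<phi> ` (M \<inter> U) = V \<inter> S"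
begin

text \<open>Indexed by the point \<open>q\<close> of the manifold rather than by its coordinate, so
  that a fixed \<open>w\<close> in \<open>S\<close> yields a tangent vector field near a
  point.\<close>

definition param_differential :: "'a \<Rightarrow> 'a \<Rightarrow> 'a" where
  "param_differential q = frechet_derivative \<psi> (at (\<phi> q))"

definition chart_differential :: "'a \<Rightarrow> 'a \<Rightarrow> 'a" where
  "chart_differential q = frechet_derivative \<phi> (at q)"

lemma \<phi>_in_V: "q \<in> U \<Longrightarrow> \<phi> q \<in> V" and \<psi>_\<phi>: "q \<in> U \<Longrightarrow> \<psi> (\<phi> q) = q"
  and \<phi>_\<psi>: "y \<in> V \<Longrightarrow> \<phi> (\<psi> y) = y"
  using homeo unfolding homeomorphism_def by auto

lemma \<phi>_deriv: "q \<in> U \<Longrightarrow> (\<phi> has_derivative chart_differential q) (at q)"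
  and \<psi>_deriv: "q \<in> U \<Longrightarrow> (\<psi> has_derivative param_differential q) (at (\<phi> q))"
  unfolding chart_differential_def param_differential_def
  using Ck_on_imp_C1(1)[OF smooth_\<phi>] Ck_on_imp_C1(1)[OF smooth_\<psi>] \<phi>_in_V by auto

lemma linear_param_differential: "q \<in> U \<Longrightarrow> linear (param_differential q)"
  by (rule has_derivative_linear[OF \<psi>_deriv])

text \<open>Differentiate \<open>\<psi> (\<phi> x) = x\<close>, which holds on the whole open set
  \<open>U\<close>.\<close>

lemma param_differential_chart_differential:
  assumes "q \<in> U"
  shows "param_differential q (chart_differential q v) = v"
proof -
  have "((\<lambda>x. \<psi> (\<phi> x)) has_derivative (\<lambda>v. param_differential q (chart_differential q v))) (at q)"
    by (rule has_derivative_compose[OF \<phi>_deriv \<psi>_deriv]) (use assms in auto)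
  then have "((\<lambda>x. x) has_derivative (\<lambda>v. param_differential q (chart_differential q v))) (at q)"
    by (rule has_derivative_transform_within_open[OF _ open_U assms \<psi>_\<phi>])
  then show ?thesis
    using has_derivative_unique[OF _ has_derivative_ident] by metis
qed

lemma chart_differential_param_differential:
  assumes "q \<in> U"
  shows "chart_differential q (param_differential q v) = v"
proof -
  have "(\<phi> has_derivative chart_differential q) (at (\<psi> (\<phi> q)))"
    using \<phi>_deriv[OF assms] \<psi>_\<phi>[OF assms] by simp
  then have "((\<lambda>y. \<phi> (\<psi> y)) has_derivative (\<lambda>v. chart_differential q (param_differential q v))) (at (\<phi> q))"
    by (rule has_derivative_compose[OF \<psi>_deriv[OF assms]])
  then have "((\<lambda>y. y) has_derivative (\<lambda>v. chart_differential q (param_differential q v))) (at (\<phi> q))"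
    by (rule has_derivative_transform_within_open[OF _ open_V \<phi>_in_V[OF assms] \<phi>_\<psi>])
  then show ?thesis
    using has_derivative_unique[OF _ has_derivative_ident] by metis
qed

text \<open>The line through \<open>\<phi> q\<close> in direction \<open>w\<close> stays in
  \<open>V \<inter> S\<close> for short times; its image under \<open>\<psi>\<close> is a curve in
  \<open>M\<close> with the required velocity.\<close>

lemma param_differential_in_tangent_space:
  assumes q: "q \<in> M" "q \<in> U" and w: "w \<in> S"
  shows "param_differential q w \<in> tangent_space M q"
proof -
  define c where "c s = \<psi> (\<phi> q + s *\<^sub>R w)" for s :: real
  have "\<phi> q \<in> V" "\<phi> q \<in> S" using q image by auto
  have "((\<lambda>s. \<phi> q + s *\<^sub>R w) \<longlongrightarrow> \<phi> q + 0 *\<^sub>R w) (nhds 0)"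
    by (intro tendsto_intros filterlim_ident)
  then have "\<forall>\<^sub>F s in nhds (0::real). \<phi> q + s *\<^sub>R w \<in> V"
    by (rule topological_tendstoD) (use open_V \<open>\<phi> q \<in> V\<close> in auto)
  then obtain e where "e > 0" and e: "\<And>s. \<bar>s\<bar> < e \<Longrightarrow> \<phi> q + s *\<^sub>R w \<in> V"
    by (auto simp: eventually_nhds_metric dist_real_def)
  have "Ck_on \<infinity> {-e<..<e} c"
    unfolding Ck_on_def c_def
    using smooth_\<psi> e by (auto simp: Ck_on_def intro!: nat_Ck_on_line[of _ _ _ V])
  moreover have "c s \<in> M" if "\<bar>s\<bar> < e" for s
  proof -
    have "\<phi> q + s *\<^sub>R w \<in> V \<inter> S"
      using e[OF that] S w \<open>\<phi> q \<in> S\<close> by (simp add: subspace_add subspace_scale)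
    then obtain y where "y \<in> M \<inter> U" "\<phi> q + s *\<^sub>R w = \<phi> y" using image by blast
    then show ?thesis using \<psi>_\<phi>[of y] by (simp add: c_def)
  qed
  moreover have "c 0 = q" using \<psi>_\<phi> q by (simp add: c_def)
  moreover have "(c has_vector_derivative param_differential q w) (at 0)"
  proof -
    have "((\<lambda>s. \<phi> q + s *\<^sub>R w) has_derivative (\<lambda>r. r *\<^sub>R w)) (at 0)"
      by (auto intro!: derivative_eq_intros)
    moreover have "(\<psi> has_derivative param_differential q) (at (\<phi> q + 0 *\<^sub>R w))"
      using \<psi>_deriv q by simp
    ultimately have "(c has_derivative (\<lambda>r. param_differential q (r *\<^sub>R w))) (at 0)"
      unfolding c_def by (rule has_derivative_compose)
    then show ?thesis
      using linear_param_differential[OF q(2)] by (simp add: has_vector_derivative_def linear_cmul)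
  qed
  ultimately have "smooth_curve_through M q (param_differential q w) c"
    unfolding smooth_curve_through_def using \<open>e > 0\<close> by (auto intro!: exI[of _ e])
  then show ?thesis by (auto simp: tangent_space_def)
qed

text \<open>In the chart, a curve in \<open>M\<close> runs inside \<open>S\<close> near time 0, and
  so does its velocity.\<close>

lemma chart_differential_in_S:
  assumes q: "q \<in> U" and "v \<in> tangent_space M q"
  shows "chart_differential q v \<in> S"
proof -
  obtain c where c: "smooth_curve_through M q v c"
    using assms(2) by (auto simp: tangent_space_def)
  then have c0: "c 0 = q" "(c has_derivative (\<lambda>r. r *\<^sub>R v)) (at 0)"
    by (auto simp: smooth_curve_through_def has_vector_derivative_def)
  have "(\<phi> has_derivative chart_differential q) (at (c 0))"
    using \<phi>_deriv[OF q] c0 by simp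
  then have "((\<lambda>s. \<phi> (c s)) has_derivative (\<lambda>r. chart_differential q (r *\<^sub>R v))) (at 0)"
    by (rule has_derivative_compose[OF c0(2)])
  then have "((\<lambda>s. \<phi> (c s)) has_vector_derivative chart_differential q v) (at 0)"
    using has_derivative_linear[OF \<phi>_deriv[OF q]]
    by (simp add: has_vector_derivative_def linear_cmul)
  moreover have "\<forall>\<^sub>F s in nhds 0. \<phi> (c s) \<in> S"
    using smooth_curve_through_eventually[OF c open_U q]
    by eventually_elim (use image in blast)
  ultimately show ?thesis
    using has_vector_derivative_in_subspace S by blast
qed

text \<open>Closure of the curve velocities under addition is not visible from their definition; as
  a linear image of \<open>S\<close> they form a subspace, and injectivity gives its
  dimension.\<close>

lemma tangent_space_eq:
  assumes "q \<in> M" "q \<in> U"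
  shows "tangent_space M q = param_differential q ` S"
proof
  show "tangent_space M q \<subseteq> param_differential q ` S"
  proof
    fix v assume "v \<in> tangent_space M q"
    then have "chart_differential q v \<in> S" by (rule chart_differential_in_S[OF assms(2)])
    then show "v \<in> param_differential q ` S"
      using param_differential_chart_differential[OF assms(2), of v] by (metis image_eqI)
  qed
  show "param_differential q ` S \<subseteq> tangent_space M q"
    using param_differential_in_tangent_space[OF assms] by blast
qed

lemma subspace_tangent_space: "q \<in> M \<Longrightarrow> q \<in> U \<Longrightarrow> subspace (tangent_space M q)"
  by (simp add: tangent_space_eq linear_subspace_image linear_param_differential S)

lemma dim_tangent_space:
  assumes "q \<in> M" "q \<in> U"
  shows "dim (tangent_space M q) = dim S"
proof -
  have "inj (param_differential q)"
    using chart_differential_param_differential[OF assms(2)] by (metis injI)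
  then show ?thesis
    using assms by (simp add: tangent_space_eq dim_image_eq linear_param_differential inj_on_subset)
qed

text \<open>Used to carry a tangent vector at a limit point continuously to the nearby
  iterates.\<close>

lemma continuous_on_param_differential: "continuous_on U (\<lambda>q. param_differential q w)"
  unfolding param_differential_def
proof (rule continuous_on_compose2[of V "\<lambda>y. frechet_derivative \<psi> (at y) w"])
  show "continuous_on V (\<lambda>y. frechet_derivative \<psi> (at y) w)"
    by (rule Ck_on_imp_C1(2)[OF smooth_\<psi>]) simp
  show "continuous_on U \<phi>" by (rule Ck_on_imp_continuous_on[OF smooth_\<phi>])
qed (use \<phi>_in_V in auto)

end

section \<open>The differential and the Riemannian gradient\<close>

text \<open>By the chain rule \<open>D v\<close> is the derivative along every admissible curve;
  tangency of \<open>v\<close> supplies at least one such curve, which makes the definite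
  description unique.\<close>

lemma differential_on_eq:
  assumes "open U" "p \<in> U" "(F has_derivative D) (at p)" "\<And>x. x \<in> M \<inter> U \<Longrightarrow> F x = f x"
    and "v \<in> tangent_space M p"
  shows "differential_on M f p v = D v"
proof -
  have curve: "((f \<circ> c) has_real_derivative D v) (at 0)" if c: "smooth_curve_through M p v c" for c
  proof -
    from c have c0: "c 0 = p" "(c has_derivative (\<lambda>r. r *\<^sub>R v)) (at 0)"
      by (auto simp: smooth_curve_through_def has_vector_derivative_def)
    have "(F has_derivative D) (at (c 0))" using assms(3) c0 by simp
    then have "((\<lambda>s. F (c s)) has_derivative (\<lambda>r. D (r *\<^sub>R v))) (at 0)"
      by (rule has_derivative_compose[OF c0(2)])
    moreover have "(\<lambda>r. D (r *\<^sub>R v)) = (*) (D v)"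
      using has_derivative_linear[OF assms(3)] by (auto simp: linear_cmul)
    ultimately have "((\<lambda>s. F (c s)) has_real_derivative D v) (at 0)"
      by (simp add: has_field_derivative_def)
    moreover have "\<forall>\<^sub>F s in nhds 0. F (c s) = (f \<circ> c) s"
      using smooth_curve_through_eventually[OF c assms(1,2)]
      by eventually_elim (use assms(4) in auto)
    ultimately show ?thesis
      using DERIV_cong_ev[OF refl _ refl, of "\<lambda>s. F (c s)" "f \<circ> c" 0 "D v"] by blast
  qed
  obtain c where "smooth_curve_through M p v c"
    using assms(5) by (auto simp: tangent_space_def)
  then show ?thesis
    unfolding differential_on_def by (intro the_equality) (auto intro: curve DERIV_unique)
qed

text \<open>The common dimension \<open>d\<close> is kept because invertibility of the transport
  compares tangent spaces at different points.\<close>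

lemma embedded_submanifold_charts:
  assumes "embedded_submanifold M"
  obtains d where "\<And>p. p \<in> M \<Longrightarrow> \<exists>U V S \<phi> \<psi>. p \<in> U \<and> submanifold_chart M U V S \<phi> \<psi> \<and> dim S = d"
proof -
  obtain d where "\<forall>p\<in>M. \<exists>U V S. \<exists>\<phi> \<psi> :: 'a \<Rightarrow> 'a.
        open U \<and> open V \<and> p \<in> U \<and> homeomorphism U V \<phi> \<psi> \<and> Ck_on \<infinity> U \<phi> \<and> Ck_on \<infinity> V \<psi> \<and>
        subspace S \<and> dim S = d \<and> \<phi> ` (M \<inter> U) = V \<inter> S"
    using assms unfolding embedded_submanifold_def by (rule exE)
  then show thesis
    by (intro that[of d]) (simp only: submanifold_chart_def, metis)
qed

lemma tangent_space_subspace: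
  assumes "embedded_submanifold M" "p \<in> M"
  shows "subspace (tangent_space M p)"
  using embedded_submanifold_charts[OF assms(1)] assms(2)
    submanifold_chart.subspace_tangent_space by metis

lemma dim_tangent_space_eq:
  assumes "embedded_submanifold M" "p \<in> M" "q \<in> M"
  shows "dim (tangent_space M p) = dim (tangent_space M q)"
  using embedded_submanifold_charts[OF assms(1)] assms(2,3)
    submanifold_chart.dim_tangent_space by metis

lemma subspace_inner_tangent_space:
  assumes "riemannian_submanifold M ip" "p \<in> M"
  shows "subspace_inner (tangent_space M p) (ip p)"
  using assms tangent_space_subspace
  by (auto simp: riemannian_submanifold_def subspace_inner_def)

text \<open>One ambient extension serves all base points near \<open>p\<close>, so the differentials
  at varying points become comparable.\<close>

lemma C1_map_on_extension:
  assumes "Ck_map_on 1 M f" "p \<in> M"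
  obtains U F where "open U" "p \<in> U"
    and "\<And>x v. x \<in> M \<inter> U \<Longrightarrow> v \<in> tangent_space M x \<Longrightarrow>
           differential_on M f x v = frechet_derivative F (at x) v"
    and "\<And>x. x \<in> U \<Longrightarrow> linear (frechet_derivative F (at x))"
    and "\<And>v. continuous_on U (\<lambda>x. frechet_derivative F (at x) v)"
proof -
  obtain U F where U: "open U" "p \<in> U" "Ck_on 1 U F" "\<forall>x\<in>M \<inter> U. F x = f x"
    using assms unfolding Ck_map_on_def by metis
  note deriv = Ck_on_imp_C1[OF U(3) order_refl]
  show thesis
  proof (rule that[OF U(1,2)])
    show "differential_on M f x v = frechet_derivative F (at x) v"
      if "x \<in> M \<inter> U" "v \<in> tangent_space M x" for x v
      using differential_on_eq[OF U(1) _ deriv(1), of x M f v] that U(4) by blast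
    show "linear (frechet_derivative F (at x))" if "x \<in> U" for x
      by (rule has_derivative_linear[OF deriv(1)[OF that]])
  qed (rule deriv(2))
qed

text \<open>Near \<open>p\<close> the differential is the derivative of an ambient extension, hence
  linear on the tangent space, and \<open>Riesz\<close> makes the definite description of the
  gradient meaningful.\<close>

lemma rgrad:
  assumes M: "riemannian_submanifold M ip" and f: "Ck_map_on 1 M f" and p: "p \<in> M"
  shows "rgrad M ip f p \<in> tangent_space M p"
    and "\<xi> \<in> tangent_space M p \<Longrightarrow> ip p (rgrad M ip f p) \<xi> = differential_on M f p \<xi>"
proof -
  interpret subspace_inner "tangent_space M p" "ip p"
    by (rule subspace_inner_tangent_space[OF M p])
  obtain U F where U: "p \<in> U"
    and D: "\<And>x v. x \<in> M \<inter> U \<Longrightarrow> v \<in> tangent_space M x \<Longrightarrow>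
           differential_on M f x v = frechet_derivative F (at x) v"
    and lin: "\<And>x. x \<in> U \<Longrightarrow> linear (frechet_derivative F (at x))"
    by (rule C1_map_on_extension[OF f p]) blast
  have "\<exists>!u. u \<in> tangent_space M p \<and> (\<forall>v\<in>tangent_space M p. ip p u v = differential_on M f p v)"
  proof (rule Riesz)
    fix u v assume "u \<in> tangent_space M p" "v \<in> tangent_space M p"
    then show "differential_on M f p (u + v) = differential_on M f p u + differential_on M f p v"
      using D[of p] p U S by (simp add: subspace_add linear_add[OF lin[OF U]])
  next
    fix r u assume "u \<in> tangent_space M p"
    then show "differential_on M f p (r *\<^sub>R u) = r * differential_on M f p u"
      using D[of p] p U S by (simp add: subspace_scale linear_cmul[OF lin[OF U]])
  qed
  from theI'[OF this] show "rgrad M ip f p \<in> tangent_space M p"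
    and "\<xi> \<in> tangent_space M p \<Longrightarrow> ip p (rgrad M ip f p) \<xi> = differential_on M f p \<xi>"
    unfolding rgrad_def by blast+
qed

text \<open>A tangent vector at the limit point is moved to nearby points by a chart, and the gradients
  there are tested against the resulting vectors.\<close>

lemma rgrad_limit_eq_0:
  assumes M: "riemannian_submanifold M ip" and f: "Ck_map_on 1 M f"
    and p: "p \<in> M" and y: "\<forall>\<^sub>F n in sequentially. y n \<in> M" "y \<longlonglongrightarrow> p"
    and grad: "(\<lambda>n. rnorm ip (y n) (rgrad M ip f (y n))) \<longlonglongrightarrow> 0"
  shows "rgrad M ip f p = 0"
proof -
  have emb: "embedded_submanifold M"
    and cont_ip: "continuous_on (tangent_bundle2 M) (\<lambda>(x, v, w). ip x v w)"
    using M Ck_map_on_imp_continuous_on unfolding riemannian_submanifold_def by auto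
  obtain U V S \<phi> \<psi> where "p \<in> U" and chart: "submanifold_chart M U V S \<phi> \<psi>"
    using embedded_submanifold_charts[OF emb] p by metis
  interpret submanifold_chart M U V S \<phi> \<psi> by (rule chart)
  obtain W F where W: "open W" "p \<in> W"
    and D: "\<And>x v. x \<in> M \<inter> W \<Longrightarrow> v \<in> tangent_space M x \<Longrightarrow>
           differential_on M f x v = frechet_derivative F (at x) v"
    and lin: "\<And>x. x \<in> W \<Longrightarrow> linear (frechet_derivative F (at x))"
    and contD: "\<And>v. continuous_on W (\<lambda>x. frechet_derivative F (at x) v)"
    by (rule C1_map_on_extension[OF f p]) blast
  have "\<forall>\<^sub>F n in sequentially. y n \<in> U" "\<forall>\<^sub>F n in sequentially. y n \<in> W"
    using topological_tendstoD[OF y(2)] open_U \<open>p \<in> U\<close> W by auto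
  with y(1) have near: "\<forall>\<^sub>F n in sequentially. y n \<in> M \<and> y n \<in> U \<and> y n \<in> W"
    by eventually_elim simp
  have "differential_on M f p \<xi> = 0" if \<xi>: "\<xi> \<in> tangent_space M p" for \<xi>
  proof -
    define \<zeta> where "\<zeta> n = param_differential (y n) (chart_differential p \<xi>)" for n
    have "\<zeta> \<longlonglongrightarrow> param_differential p (chart_differential p \<xi>)"
      unfolding \<zeta>_def
      by (rule continuous_on_tendsto_compose[OF continuous_on_param_differential y(2) \<open>p \<in> U\<close>])
        (use near in \<open>auto elim: eventually_mono\<close>)
    then have \<zeta>: "\<zeta> \<longlonglongrightarrow> \<xi>"
      using param_differential_chart_differential[OF \<open>p \<in> U\<close>] by simp
    have near\<zeta>: "\<forall>\<^sub>F n in sequentially. y n \<in> M \<and> y n \<in> W \<and> \<zeta> n \<in> tangent_space M (y n)"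
      using near
      by eventually_elim (use chart_differential_in_S[OF \<open>p \<in> U\<close> \<xi>] in
          \<open>auto simp: \<zeta>_def intro: param_differential_in_tangent_space\<close>)
    \<comment> \<open>Continuity of the derivative is known for each fixed direction, but
      \<open>\<zeta> n\<close> moves with the base point; expansion in \<open>Basis\<close> reduces
      to fixed directions.\<close>
    have expand: "frechet_derivative F (at x) v = (\<Sum>b\<in>Basis. (v \<bullet> b) * frechet_derivative F (at x) b)"
      if "x \<in> W" for x v
    proof -
      have "frechet_derivative F (at x) (\<Sum>b\<in>Basis. (v \<bullet> b) *\<^sub>R b)
          = (\<Sum>b\<in>Basis. (v \<bullet> b) * frechet_derivative F (at x) b)"
        using lin[OF that] by (simp add: linear_sum linear_cmul)
      then show ?thesis by (simp add: euclidean_representation)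
    qed
    have "(\<lambda>n. \<Sum>b\<in>Basis. (\<zeta> n \<bullet> b) * frechet_derivative F (at (y n)) b)
        \<longlonglongrightarrow> (\<Sum>b\<in>Basis. (\<xi> \<bullet> b) * frechet_derivative F (at p) b)"
    proof (intro tendsto_intros \<zeta>)
      show "(\<lambda>n. frechet_derivative F (at (y n)) b) \<longlonglongrightarrow> frechet_derivative F (at p) b" for b
        by (rule continuous_on_tendsto_compose[OF contD y(2) W(2)])
          (use near in \<open>auto elim: eventually_mono\<close>)
    qed
    moreover have "\<forall>\<^sub>F n in sequentially. differential_on M f (y n) (\<zeta> n)
        = (\<Sum>b\<in>Basis. (\<zeta> n \<bullet> b) * frechet_derivative F (at (y n)) b)"
      using near\<zeta> by eventually_elim (use D expand in force)
    moreover have "differential_on M f p \<xi> = (\<Sum>b\<in>Basis. (\<xi> \<bullet> b) * frechet_derivative F (at p) b)"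
      using D[of p \<xi>] expand[OF W(2), of \<xi>] p W(2) \<xi> by simp
    ultimately have lim: "(\<lambda>n. differential_on M f (y n) (\<zeta> n)) \<longlonglongrightarrow> differential_on M f p \<xi>"
      by (simp add: tendsto_cong)
    \<comment> \<open>Continuity of the metric keeps the norms of the \<open>\<zeta> n\<close>
      bounded, so Cauchy-Schwarz and the vanishing gradients force the differentials to 0.\<close>
    have "(\<lambda>n. (\<lambda>(x, v, w). ip x v w) (y n, \<zeta> n, \<zeta> n)) \<longlonglongrightarrow> (\<lambda>(x, v, w). ip x v w) (p, \<xi>, \<xi>)"
    proof (rule continuous_on_tendsto_compose[OF cont_ip])
      show "(\<lambda>n. (y n, \<zeta> n, \<zeta> n)) \<longlonglongrightarrow> (p, \<xi>, \<xi>)"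
        by (intro tendsto_intros y \<zeta>)
      show "\<forall>\<^sub>F n in sequentially. (y n, \<zeta> n, \<zeta> n) \<in> tangent_bundle2 M"
        using near\<zeta> by eventually_elim (simp add: tangent_bundle2_def)
    qed (use p \<xi> in \<open>simp add: tangent_bundle2_def\<close>)
    then have "(\<lambda>n. rnorm ip (y n) (rgrad M ip f (y n)) * sqrt (ip (y n) (\<zeta> n) (\<zeta> n)))
        \<longlonglongrightarrow> 0 * sqrt (ip p \<xi> \<xi>)"
      by (intro tendsto_mult grad tendsto_real_sqrt) simp
    moreover have "\<forall>\<^sub>F n in sequentially. norm (differential_on M f (y n) (\<zeta> n))
        \<le> rnorm ip (y n) (rgrad M ip f (y n)) * sqrt (ip (y n) (\<zeta> n) (\<zeta> n))"
      using near\<zeta>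
    proof eventually_elim
      case (elim n)
      interpret subspace_inner "tangent_space M (y n)" "ip (y n)"
        using subspace_inner_tangent_space[OF M] elim by blast
      show ?case
        using Cauchy_Schwarz[OF rgrad(1)[OF M f], of "\<zeta> n"] rgrad(2)[OF M f, of "y n" "\<zeta> n"] elim
        by (simp add: rnorm_def)
    qed
    ultimately have "(\<lambda>n. differential_on M f (y n) (\<zeta> n)) \<longlonglongrightarrow> 0"
      by (simp add: Lim_null_comparison)
    with lim show ?thesis by (rule LIMSEQ_unique)
  qed
  then have "ip p (rgrad M ip f p) (rgrad M ip f p) = 0"
    using rgrad[OF M f p] by simp
  then show ?thesis
    using subspace_inner.b_pos[OF subspace_inner_tangent_space[OF M p] rgrad(1)[OF M f p]] by force
qed

section \<open>Isometric transport\<close>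

text \<open>Isometry makes the kernel trivial and equal dimensions make the transport onto, so
  \<open>inv_into\<close> returns a true preimage, whose norm is unchanged by isometry.\<close>

lemma inverse_transport:
  assumes M: "riemannian_submanifold M ip" and R: "manifold_retraction M R"
    and T: "vector_transport M R T" and iso: "isometric_transport M ip R T"
    and y: "y \<in> M" and \<eta>: "\<eta> \<in> tangent_space M y" and u: "u \<in> tangent_space M (R y \<eta>)"
  shows "inverse_transport M T y \<eta> u \<in> tangent_space M y"
    and "rnorm ip y (inverse_transport M T y \<eta> u) = rnorm ip (R y \<eta>) u"
proof -
  have emb: "embedded_submanifold M" using M by (simp add: riemannian_submanifold_def)
  have Ry: "R y \<eta> \<in> M" using R y \<eta> by (simp add: manifold_retraction_def)
  interpret y: subspace_inner "tangent_space M y" "ip y"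
    by (rule subspace_inner_tangent_space[OF M y])
  interpret Ry: subspace_inner "tangent_space M (R y \<eta>)" "ip (R y \<eta>)"
    by (rule subspace_inner_tangent_space[OF M Ry])
  have isometry: "ip (R y \<eta>) (T y \<eta> v) (T y \<eta> v) = ip y v v" if "v \<in> tangent_space M y" for v
    using iso y \<eta> that by (simp add: isometric_transport_def)
  have "T y \<eta> ` tangent_space M y = tangent_space M (R y \<eta>)"
  proof (rule linear_on_subspace_surj)
    show "dim (tangent_space M y) = dim (tangent_space M (R y \<eta>))"
      by (rule dim_tangent_space_eq[OF emb y Ry])
    show "v = 0" if "v \<in> tangent_space M y" "T y \<eta> v = 0" for v
      using isometry[OF that(1)] that y.b_pos[OF that(1)] Ry.b_zero[OF subspace_0[OF Ry.S]] by force
  qed (use T y \<eta> in \<open>auto simp: vector_transport_def y.S Ry.S\<close>)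
  with u have "u \<in> T y \<eta> ` tangent_space M y" by simp
  note inv_into_into[OF this] f_inv_into_f[OF this]
  then show "inverse_transport M T y \<eta> u \<in> tangent_space M y"
    and "rnorm ip y (inverse_transport M T y \<eta> u) = rnorm ip (R y \<eta>) u"
    unfolding inverse_transport_def rnorm_def using isometry by metis+
qed

section \<open>The inexact gradient method\<close>

text \<open>Translates one iteration into the two scalar inequalities required by
  \<open>inexact_descent_convergent\<close>.\<close>

lemma IRGD_step:
  assumes M: "riemannian_submanifold M ip" and R: "manifold_retraction M R"
    and T: "vector_transport M R T" and iso: "isometric_transport M ip R T"
    and f: "Ck_map_on 1 M f" and "0 < L" and "0 < t"
    and descent: "\<forall>y\<in>M. \<forall>\<eta>\<in>tangent_space M y.
      f (R y \<eta>) \<le> f y + ip y (rgrad M ip f y) \<eta> + L / 2 * (rnorm ip y \<eta>)\<^sup>2"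
    and lipschitz: "\<forall>y\<in>M. \<forall>\<eta>\<in>tangent_space M y.
      rnorm ip y (inverse_transport M T y \<eta> (rgrad M ip f (R y \<eta>)) - rgrad M ip f y)
        \<le> L * rnorm ip y \<eta>"
    and y: "y \<in> M" and g: "g \<in> tangent_space M y" and err: "rnorm ip y (g - rgrad M ip f y) \<le> \<epsilon>"
  defines "z \<equiv> R y (- t *\<^sub>R g)" and "G \<equiv> rnorm ip y (rgrad M ip f y)"
  shows "f z \<le> f y - t * (G\<^sup>2 - \<epsilon> * G) + L / 2 * t\<^sup>2 * (G + \<epsilon>)\<^sup>2"
    and "rnorm ip z (rgrad M ip f z) \<le> G + L * t * (G + \<epsilon>)"
proof -
  interpret subspace_inner "tangent_space M y" "ip y"
    by (rule subspace_inner_tangent_space[OF M y])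
  define d where "d = rgrad M ip f y"
  have d: "d \<in> tangent_space M y" unfolding d_def by (rule rgrad(1)[OF M f y])
  have G: "G = sqrt (ip y d d)" by (simp add: G_def d_def rnorm_def)
  then have "0 \<le> G" using b_nonneg[OF d] by simp
  have G2: "G\<^sup>2 = ip y d d" using b_nonneg[OF d] by (simp add: G)
  have gd: "g - d \<in> tangent_space M y" using g d S by (simp add: subspace_diff)
  have err': "sqrt (ip y (g - d) (g - d)) \<le> \<epsilon>" using err by (simp add: rnorm_def d_def)
  have \<eta>: "- t *\<^sub>R g \<in> tangent_space M y" using g S by (simp only: subspace_scale)
  have "z \<in> M" using R y \<eta> unfolding z_def manifold_retraction_def by blast
  have norm_g: "rnorm ip y g \<le> G + \<epsilon>"
    using triangle[OF d gd] err' by (simp add: rnorm_def G)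
  have norm_g_nonneg: "0 \<le> rnorm ip y g" using b_nonneg[OF g] by (simp add: rnorm_def)
  have norm_\<eta>: "rnorm ip y (- t *\<^sub>R g) = t * rnorm ip y g"
    using sqrt_scale[OF g, of "- t"] \<open>0 < t\<close> by (simp add: rnorm_def)
  \<comment> \<open>Writing \<open>g\<close> as \<open>d + (g - d)\<close> bounds its inner product
    with \<open>d\<close> from below by \<open>G\<^sup>2 - \<epsilon> * G\<close>.\<close>
  have "\<bar>ip y d (g - d)\<bar> \<le> G * \<epsilon>"
    using Cauchy_Schwarz[OF d gd] mult_left_mono[OF err' \<open>0 \<le> G\<close>] by (simp add: G)
  moreover have "ip y d (g - d) = ip y d g - G\<^sup>2"
    using b_diff_right[OF g d d] by (simp add: G2)
  ultimately have "G\<^sup>2 - \<epsilon> * G \<le> ip y d g" by (simp add: mult.commute)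
  then have "t * (G\<^sup>2 - \<epsilon> * G) \<le> t * ip y d g"
    using \<open>0 < t\<close> by (simp add: mult_left_mono)
  moreover have "ip y d (- t *\<^sub>R g) = - (t * ip y d g)"
    using b_scale_right[OF d g, of "- t"] by simp
  moreover have "L / 2 * (t * rnorm ip y g)\<^sup>2 \<le> L / 2 * (t * (G + \<epsilon>))\<^sup>2"
    using norm_g norm_g_nonneg \<open>0 < t\<close> \<open>0 < L\<close> by (intro mult_left_mono power_mono) auto
  moreover have "f z \<le> f y + ip y d (- t *\<^sub>R g) + L / 2 * (rnorm ip y (- t *\<^sub>R g))\<^sup>2"
    unfolding z_def d_def using descent y \<eta> by blast
  ultimately show "f z \<le> f y - t * (G\<^sup>2 - \<epsilon> * G) + L / 2 * t\<^sup>2 * (G + \<epsilon>)\<^sup>2"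
    unfolding norm_\<eta> by (simp add: power_mult_distrib mult.assoc)
  \<comment> \<open>The gradient at \<open>z\<close> is pulled back to the tangent space at
    \<open>y\<close> without changing its norm; there it can be compared with \<open>d\<close> by
    the triangle inequality.\<close>
  define u where "u = inverse_transport M T y (- t *\<^sub>R g) (rgrad M ip f z)"
  have u: "u \<in> tangent_space M y" "rnorm ip y u = rnorm ip z (rgrad M ip f z)"
    using inverse_transport[OF M R T iso y \<eta>] rgrad(1)[OF M f \<open>z \<in> M\<close>]
    unfolding u_def z_def by blast+
  have "rnorm ip y (u - d) \<le> L * (t * rnorm ip y g)"
    using lipschitz y \<eta> unfolding u_def d_def z_def norm_\<eta>[symmetric] by blast
  also have "\<dots> \<le> L * (t * (G + \<epsilon>))"
    using norm_g \<open>0 < t\<close> \<open>0 < L\<close> by simp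
  finally show "rnorm ip z (rgrad M ip f z) \<le> G + L * t * (G + \<epsilon>)"
    using triangle[OF d subspace_diff[OF S u(1) d]] u(2) by (simp add: G rnorm_def mult.assoc)
qed

lemma not_summable_if_partial_sums_at_top:
  fixes t :: "nat \<Rightarrow> real"
  assumes "filterlim (\<lambda>n. \<Sum>k=1..n. t k) at_top sequentially"
  shows "\<not> summable t"
proof
  assume "summable t"
  then have "(\<lambda>n. \<Sum>k\<le>n. t k) \<longlonglongrightarrow> suminf t"
    by (rule summable_LIMSEQ')
  \<comment> \<open>The given partial sums start at 1, whereas \<open>summable\<close> also counts
    \<open>t 0\<close>.\<close>
  then have "(\<lambda>n. (\<Sum>k\<le>n. t k) - t 0) \<longlonglongrightarrow> suminf t - t 0"
    by (intro tendsto_intros)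
  moreover have "(\<Sum>k\<le>n. t k) - t 0 = (\<Sum>k=1..n. t k)" for n
    by (simp add: atMost_atLeast0 sum.atLeast_Suc_atMost)
  ultimately have "(\<lambda>n. \<Sum>k=1..n. t k) \<longlonglongrightarrow> suminf t - t 0" by simp
  then show False
    using assms not_tendsto_and_filterlim_at_infinity[OF sequentially_bot]
      filterlim_at_top_imp_at_infinity by blast
qed

theorem theorem3p9:
  fixes M :: "(real ^ 'n) set"
    and ip :: "real ^ 'n \<Rightarrow> real ^ 'n \<Rightarrow> real ^ 'n \<Rightarrow> real"
    and R :: "real ^ 'n \<Rightarrow> real ^ 'n \<Rightarrow> real ^ 'n"
    and T :: "real ^ 'n \<Rightarrow> real ^ 'n \<Rightarrow> real ^ 'n \<Rightarrow> real ^ 'n"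
    and f :: "real ^ 'n \<Rightarrow> real"
    and L :: real
    and t \<epsilon> :: "nat \<Rightarrow> real"
    and x g :: "nat \<Rightarrow> real ^ 'n"
  assumes "riemannian_submanifold M ip"
    and "manifold_retraction M R"
    and "vector_transport M R T"
    and "isometric_transport M ip R T"
    and "Ck_map_on 1 M f"
    and "L > 0"
    and descent: "\<forall>y\<in>M. \<forall>\<eta>\<in>tangent_space M y.
      f (R y \<eta>) \<le> f y + ip y (rgrad M ip f y) \<eta> + L / 2 * (rnorm ip y \<eta>)\<^sup>2"
    and lipschitz: "\<forall>y\<in>M. \<forall>\<eta>\<in>tangent_space M y.
      rnorm ip y (inverse_transport M T y \<eta> (rgrad M ip f (R y \<eta>)) - rgrad M ip f y)
        \<le> L * rnorm ip y \<eta>"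
    and t_pos: "\<forall>k\<ge>1. t k > 0"
    and eps_pos: "\<forall>k\<ge>1. \<epsilon> k > 0"
    and t_sum: "filterlim (\<lambda>n. \<Sum>k=1..n. t k) at_top sequentially"
    and t_decreasing: "antimono_on {1..} t"
    and t_lim: "t \<longlonglongrightarrow> 0"
    and te_sum: "summable (\<lambda>k. t (Suc k) * \<epsilon> (Suc k))"
    and eps_limsup: "limsup (\<lambda>k. ereal (\<epsilon> k)) < 2"
    and "IRGD_sequence M ip R f t \<epsilon> x g"
    and f_bdd: "bdd_below ((\<lambda>k. f (x k)) ` {1..})"
  shows "((\<lambda>k. rnorm ip (x k) (rgrad M ip f (x k))) \<longlonglongrightarrow> 0 \<and>
          (\<forall>xbar. accumulation_point_in M x xbar \<longrightarrow> stationary_point M ip f xbar)) \<and>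
         (\<forall>xbar. accumulation_point_in M x xbar \<longrightarrow> (\<lambda>k. f (x k)) \<longlonglongrightarrow> f xbar)"
proof -
  note M = assms(1) and R = assms(2) and T = assms(3) and iso = assms(4) and f = assms(5)
  have seq: "x k \<in> M" "g k \<in> tangent_space M (x k)"
      "rnorm ip (x k) (g k - rgrad M ip f (x k)) \<le> \<epsilon> k" "x (Suc k) = R (x k) (- t k *\<^sub>R g k)"
    if "1 \<le> k" for k
    using assms(16) that by (auto simp: IRGD_sequence_def)
  define G where "G k = rnorm ip (x k) (rgrad M ip f (x k))" for k
  have step: "f (x (Suc k)) \<le> f (x k) - t k * ((G k)\<^sup>2 - \<epsilon> k * G k) + L / 2 * (t k)\<^sup>2 * (G k + \<epsilon> k)\<^sup>2"
    "G (Suc k) \<le> G k + L * t k * (G k + \<epsilon> k)" if "1 \<le> k" for k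
    using IRGD_step[OF M R T iso f \<open>L > 0\<close> _ descent lipschitz seq(1-3)[OF that], of "t k"] t_pos that
    by (simp_all add: G_def seq(4)[OF that])
  have G_nonneg: "0 \<le> G k" if "1 \<le> k" for k
    using subspace_inner.b_nonneg[OF subspace_inner_tangent_space[OF M] rgrad(1)[OF M f]] seq(1)[OF that]
    by (simp add: G_def rnorm_def)
  obtain l where l: "\<And>k. 1 \<le> k \<Longrightarrow> l \<le> f (x k)"
    using f_bdd by (auto simp: bdd_below_def)
  \<comment> \<open>A real number strictly between the limsup and 2 serves as an eventual uniform
    bound on \<open>\<epsilon>\<close>.\<close>
  obtain c where "limsup (\<lambda>k. ereal (\<epsilon> k)) < ereal c" "ereal c < 2"
    using ereal_dense2[OF eps_limsup] by blast
  then have "c < 2" and eps_le: "\<forall>\<^sub>F k in sequentially. ereal (\<epsilon> k) < ereal c"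
    using Limsup_lessD by force+
  have "\<forall>\<^sub>F k in sequentially. t k < (1 - c / 2) / 2 / L"
    using \<open>c < 2\<close> \<open>L > 0\<close> by (intro order_tendstoD(2)[OF t_lim]) simp
  with eps_le have "\<forall>\<^sub>F k in sequentially. 1 \<le> k \<and> \<epsilon> k \<le> c \<and> L * t k \<le> (1 - c / 2) / 2"
    using eventually_ge_at_top[of 1]
    by eventually_elim (use \<open>L > 0\<close> in \<open>auto simp: field_simps\<close>)
  \<comment> \<open>Besides securing both bounds, \<open>1 \<le> N\<close> keeps the shifted
    sequences away from the meaningless index 0.\<close>
  then obtain N where "1 \<le> N" and N: "\<And>n. \<epsilon> (n + N) \<le> c" "\<And>n. L * t (n + N) \<le> (1 - c / 2) / 2"
    unfolding eventually_sequentially by (metis le_add2 order_refl)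
  have "1 \<le> n + N" for n using \<open>1 \<le> N\<close> by simp
  note shifted = step[OF this] G_nonneg[OF this] l[OF this]
  have "summable (\<lambda>k. t k * \<epsilon> k)"
    using te_sum summable_Suc_iff[of "\<lambda>k. t k * \<epsilon> k"] by simp
  then have te: "summable (\<lambda>n. t (n + N) * \<epsilon> (n + N))"
    by (rule summable_ignore_initial_segment)
  have t_div: "\<not> summable (\<lambda>n. t (n + N))"
    using not_summable_if_partial_sums_at_top[OF t_sum] by (simp add: summable_iff_shift)
  have t_pos': "0 < t (n + N)" and eps_pos': "0 < \<epsilon> (n + N)" for n
    using t_pos eps_pos \<open>1 \<le> N\<close> by simp_all
  have conv: "convergent (\<lambda>n. f (x (n + N)))" and "(\<lambda>n. G (n + N)) \<longlonglongrightarrow> 0"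
    using inexact_descent_convergent[OF \<open>L > 0\<close> \<open>c < 2\<close>, of "\<lambda>n. t (n + N)" "\<lambda>n. \<epsilon> (n + N)" l
        "\<lambda>n. f (x (n + N))" "\<lambda>n. G (n + N)", OF t_pos' N(2) eps_pos' N(1) te t_div]
      shifted by simp_all
  then have G_lim: "G \<longlonglongrightarrow> 0" by (simp add: LIMSEQ_offset)
  obtain v where "(\<lambda>n. f (x (n + N))) \<longlonglongrightarrow> v" using conv by (auto simp: convergent_def)
  then have f_lim: "(\<lambda>k. f (x k)) \<longlonglongrightarrow> v" by (rule LIMSEQ_offset)
  have "stationary_point M ip f p \<and> (\<lambda>k. f (x k)) \<longlonglongrightarrow> f p" if acc: "accumulation_point_in M x p" for p
  proof -
    obtain r where p: "p \<in> M" and r: "strict_mono r" "(x \<circ> r) \<longlonglongrightarrow> p"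
      using acc by (auto simp: accumulation_point_in_def)
    have "\<forall>\<^sub>F n in sequentially. 1 \<le> n" by (rule eventually_ge_at_top)
    then have near: "\<forall>\<^sub>F n in sequentially. (x \<circ> r) n \<in> M"
      by eventually_elim (use seq(1) seq_suble[OF r(1)] in \<open>auto intro: order_trans\<close>)
    have "(\<lambda>n. rnorm ip ((x \<circ> r) n) (rgrad M ip f ((x \<circ> r) n))) \<longlonglongrightarrow> 0"
      using LIMSEQ_subseq_LIMSEQ[OF G_lim r(1)] by (simp add: G_def comp_def)
    then have "rgrad M ip f p = 0"
      by (rule rgrad_limit_eq_0[OF M f p near r(2)])
    moreover have "(\<lambda>n. f ((x \<circ> r) n)) \<longlonglongrightarrow> f p"
      by (rule continuous_on_tendsto_compose[OF Ck_map_on_imp_continuous_on[OF f] r(2) p near])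
    \<comment> \<open>The whole sequence of values already converges to \<open>v\<close>, so a
      subsequence suffices to identify the limit.\<close>
    then have "f p = v"
      using LIMSEQ_subseq_LIMSEQ[OF f_lim r(1)] LIMSEQ_unique by (fastforce simp: comp_def)
    ultimately show ?thesis using p f_lim by (simp add: stationary_point_def)
  qed
  moreover have "(\<lambda>k. rnorm ip (x k) (rgrad M ip f (x k))) = G"
    by (simp add: G_def fun_eq_iff)
  ultimately show ?thesis using G_lim by simp
qed

end
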